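(* For any even integer $a>0$ and any odd integer $b>0$, the subspace $\mathrm{span}\{1,x^a,x^{a+b}\}$ of $\mathcal{C}[-1,1]$ admits a projection of norm one, i.e. there exists a projection $P$ from $\mathcal{C}[-1,1]$ onto $\mathrm{span}\{1,x^a,x^{a+b}\}$ with $\|P\|_{\infty\to\infty}=1$. In particular, $\lambda(\mathrm{span}\{1,x^2,x^3\})=1$.
   Context: $\mathcal{C}[-1,1]$ is the space of real-valued continuous functions on $[-1,1]$ with the norm $\|f\|_\infty = \max_{x\in[-1,1]}|f(x)|$. A projection from $\mathcal{C}[-1,1]$ onto a finite-dimensional subspace $\mathcal{U}$ is a linear map $P$ from $\mathcal{C}[-1,1]$ onto $\mathcal{U}$ such that $P(u)=u$ for all $u\in\mathcal{U}$; its norm is $\|P\|_{\infty\to\infty} = \max_{\|f\|_\infty\le 1}\|P(f)\|_\infty$. The projection constant of $\mathcal{U}$ (relative to $\mathcal{C}[-1,1]$) is $\lambda(\mathcal{U}) := \min_P \|P\|_{\infty\to\infty}$, the minimum being over all (bounded) projections $P$ from $\mathcal{C}[-1,1]$ onto $\mathcal{U}$. Here $\mathrm{span}\{1,x^a,x^{a+b}\}$ denotes the span of the functions $x\mapsto 1$, $x\mapsto x^a$, $x\mapsto x^{a+b}$ on $[-1,1]$. *)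

theory Defs
  imports "HOL-Analysis.Analysis"
begin

text \<open>The interval \<open>[-1,1]\<close> as a type with the metric inherited from the reals. It is compact
  (lemma \<open>compact_UNIV_sym_interval\<close>), so every continuous real function on it is bounded
  (lemma \<open>continuous_sym_interval_bcontfun\<close>) and the library's Banach space of bounded continuous
  functions, with the supremum norm, is the whole space \<open>C[-1,1]\<close>.\<close>

typedef sym_interval = "{-1..1 :: real}"
  morphisms pt Pnt
  by (rule exI[of _ 0]) simp

instantiation sym_interval :: metric_space
begin

definition dist_sym_interval :: "sym_interval \<Rightarrow> sym_interval \<Rightarrow> real"
  where "dist_sym_interval x y = dist (pt x) (pt y)"

definition uniformity_sym_interval :: "(sym_interval \<times> sym_interval) filter"
  where "uniformity_sym_interval = (INF e\<in>{0<..}. principal {(x, y). dist x y < e})"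

definition open_sym_interval :: "sym_interval set \<Rightarrow> bool"
  where "open_sym_interval S \<longleftrightarrow>
    (\<forall>x\<in>S. eventually (\<lambda>(x', y). x' = x \<longrightarrow> y \<in> S) uniformity)"

instance
proof
  fix x y z :: sym_interval
  show "dist x y = 0 \<longleftrightarrow> x = y"
    by (simp add: dist_sym_interval_def pt_inject)
  show "dist x y \<le> dist x z + dist y z"
    unfolding dist_sym_interval_def by (rule dist_triangle2)
qed (rule uniformity_sym_interval_def open_sym_interval_def)+

end

lemma pt_bounds: "-1 \<le> pt x" "pt x \<le> 1"
  using pt[of x] by auto

lemma continuous_on_pt [continuous_intros]: "continuous_on S pt"
  unfolding continuous_on_iff dist_sym_interval_def by auto

lemma continuous_on_Pnt: "continuous_on {-1..1} Pnt"
  unfolding continuous_on_iff dist_sym_interval_def by (auto simp: Pnt_inverse)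

lemma compact_UNIV_sym_interval: "compact (UNIV :: sym_interval set)"
proof -
  have "compact (Pnt ` {-1..1})"
    by (intro compact_continuous_image continuous_on_Pnt compact_Icc)
  moreover have "Pnt ` {-1..1} = UNIV"
    by (metis pt pt_inverse UNIV_eq_I imageI)
  ultimately show ?thesis by simp
qed

lemma continuous_sym_interval_bcontfun:
  fixes f :: "sym_interval \<Rightarrow> real"
  assumes "continuous_on UNIV f"
  shows "f \<in> bcontfun"
  using compact_imp_bounded[OF compact_continuous_image[OF assms compact_UNIV_sym_interval]] assms
  by (simp add: bcontfun_def)

type_synonym C = "sym_interval \<Rightarrow>\<^sub>C real"

definition monomial :: "nat \<Rightarrow> C"
  where "monomial n = Bcontfun (\<lambda>x. pt x ^ n)"

lemma apply_monomial [simp]: "apply_bcontfun (monomial n) x = pt x ^ n"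
  unfolding monomial_def
  by (subst Bcontfun_inverse) (auto intro!: continuous_sym_interval_bcontfun continuous_intros)

definition projection_onto :: "('a::real_normed_vector \<Rightarrow> 'a) \<Rightarrow> 'a set \<Rightarrow> bool"
  where "projection_onto P U \<longleftrightarrow>
    bounded_linear P \<and> range P = U \<and> (\<forall>u\<in>U. P u = u)"

text \<open>The least norm of a projection onto \<open>U\<close>. A genuine minimum, hence meaningful only where it
  is attained, which is the case for every finite-dimensional \<open>U\<close> in \<open>C[-1,1]\<close>.\<close>

definition projection_constant :: "'a::real_normed_vector set \<Rightarrow> real"
  where "projection_constant U = (LEAST c. \<exists>P. projection_onto P U \<and> onorm P = c)"

end

(* The curve (x^a, x^(a+b)) lies in the triangle with vertices (0,0), (1,1), (1,-1), which it attains
   at x = 0, 1, -1. Hence the barycentric coordinates 1 - x^a, (x^a + x^(a+b))/2, (x^a - x^(a+b))/2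
   of the triangle form a nonnegative partition of unity on [-1,1], and interpolation at 0, 1, -1 is
   a positive projection that fixes 1. *)
theory Submission
  imports Defs
begin

text \<open>The weights are kept as combinations of \<open>monomial\<close> terms, so that
  membership of the image in the span follows from closure rules alone; estimates use the pointwise
  form \<open>tri_interp_apply\<close>.\<close>

definition tri_interp :: "nat \<Rightarrow> nat \<Rightarrow> C \<Rightarrow> C"
  where "tri_interp a b f =
    f (Pnt 0) *\<^sub>R (monomial 0 - monomial a)
    + (f (Pnt 1) / 2) *\<^sub>R (monomial a + monomial (a + b))
    + (f (Pnt (-1)) / 2) *\<^sub>R (monomial a - monomial (a + b))"

lemma pt_Pnt [simp]: "pt (Pnt 0) = 0" "pt (Pnt 1) = 1" "pt (Pnt (-1)) = -1"
  by (simp_all add: Pnt_inverse)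

lemma tri_interp_apply:
  "tri_interp a b f x = f (Pnt 0) * (1 - pt x ^ a)
    + f (Pnt 1) * ((pt x ^ a + pt x ^ (a + b)) / 2)
    + f (Pnt (-1)) * ((pt x ^ a - pt x ^ (a + b)) / 2)"
  by (simp add: tri_interp_def)

lemma linear_tri_interp: "linear (tri_interp a b)"
  by (rule linearI; rule bcontfun_eqI) (simp_all add: tri_interp_apply field_simps)

lemma tri_interp_in_span: "tri_interp a b f \<in> span {monomial 0, monomial a, monomial (a + b)}"
  unfolding tri_interp_def by (intro span_add span_scale span_diff span_base) simp_all

text \<open>Two linear maps that agree on the generators agree on the span. On the generators,
  \<open>a > 0\<close> makes the higher powers vanish at 0, and the parities give the values 1 and
  -1 at the point -1 for \<open>monomial a\<close> and \<open>monomial (a + b)\<close>.\<close>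

lemma tri_interp_fixes_span:
  assumes "even a" "a > 0" "odd b" and u: "u \<in> span {monomial 0, monomial a, monomial (a + b)}"
  shows "tri_interp a b u = u"
proof (rule linear_eq_on[OF linear_tri_interp linear_id[unfolded id_def] u])
  fix v assume "v \<in> {monomial 0, monomial a, monomial (a + b)}"
  then show "tri_interp a b v = v"
    using assms(1-3) by (intro bcontfun_eqI) (auto simp: tri_interp_apply field_simps)
qed

lemma norm_tri_interp_le:
  assumes "even a"
  shows "norm (tri_interp a b f) \<le> norm f"
proof (rule norm_bound)
  fix x :: sym_interval
  define p q where "p = pt x ^ a" and "q = pt x ^ b"
  have abs_x: "\<bar>pt x\<bar> \<le> 1"
    using pt_bounds[of x] by auto
  have p: "0 \<le> p" "p \<le> 1"
    using assms power_le_one[OF _ abs_x, of a] by (simp_all add: p_def power_even_abs zero_le_even_power)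
  have q: "\<bar>q\<bar> \<le> 1"
    using power_le_one[OF _ abs_x, of b] by (simp add: q_def power_abs)
  \<comment> \<open>This places the curve point \<open>(p, p * q)\<close> inside the triangle, which
    is exactly nonnegativity of the last two weights.\<close>
  have "\<bar>p * q\<bar> \<le> p"
    using p q by (simp add: abs_mult mult_left_le)
  then have w: "0 \<le> 1 - p" "0 \<le> (p + p * q) / 2" "0 \<le> (p - p * q) / 2"
    using p by auto
  have f: "\<bar>f y\<bar> \<le> norm f" for y
    using norm_bounded[of f y] by simp
  have weighted: "\<bar>f y * w\<bar> \<le> norm f * w" if "0 \<le> w" for y w
    using f[of y] that by (simp add: abs_mult mult_right_mono)
  have "\<bar>tri_interp a b f x\<bar> \<le> norm f * (1 - p) + norm f * ((p + p * q) / 2) + norm f * ((p - p * q) / 2)"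
    using weighted[OF w(1), of "Pnt 0"] weighted[OF w(2), of "Pnt 1"] weighted[OF w(3), of "Pnt (-1)"]
    unfolding tri_interp_apply power_add p_def[symmetric] q_def[symmetric] by linarith
  \<comment> \<open>The three weights sum to 1.\<close>
  also have "\<dots> = norm f"
    by (simp add: field_simps)
  finally show "norm (tri_interp a b f x) \<le> norm f"
    by simp
qed

lemma projection_onto_tri_interp:
  assumes "even a" "a > 0" "odd b"
  shows "projection_onto (tri_interp a b) (span {monomial 0, monomial a, monomial (a + b)})"
  unfolding projection_onto_def
proof (intro conjI ballI)
  show "bounded_linear (tri_interp a b)"
    using linear_tri_interp norm_tri_interp_le[OF assms(1)]
    by (intro bounded_linear_intro[where K = 1])
       (auto simp: linear_add linear_scale)
  show "tri_interp a b u = u" if "u \<in> span {monomial 0, monomial a, monomial (a + b)}" for u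
    using tri_interp_fixes_span[OF assms that] .
  \<comment> \<open>Every element of the span is its own image, which gives the inclusion not
    covered by \<open>tri_interp_in_span\<close>.\<close>
  then show "range (tri_interp a b) = span {monomial 0, monomial a, monomial (a + b)}"
    using tri_interp_in_span by (metis image_subsetI rangeI subsetI subset_antisym)
qed

lemma onorm_projection_ge_1:
  assumes "projection_onto P U" "u \<in> U" "u \<noteq> 0"
  shows "1 \<le> onorm P"
proof -
  have "bounded_linear P" "P u = u"
    using assms by (auto simp: projection_onto_def)
  then have "norm u \<le> onorm P * norm u"
    using onorm[of P u] by simp
  then show ?thesis
    using assms(3) by simp
qed

text \<open>The constant function 1 is a nonzero fixed vector. The bound covers every projection, so
  it serves both for the norm of \<open>tri_interp\<close> and for minimality in
  \<open>projection_constant\<close>.\<close>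

lemma onorm_projection_onto_monomials_ge_1:
  assumes "projection_onto P (span {monomial 0, monomial a, monomial c})"
  shows "1 \<le> onorm P"
proof (rule onorm_projection_ge_1[OF assms])
  show "monomial 0 \<in> span {monomial 0, monomial a, monomial c}"
    by (simp add: span_base)
  have "monomial 0 (Pnt 0) \<noteq> (0 :: C) (Pnt 0)"
    by simp
  then show "monomial 0 \<noteq> 0"
    by metis
qed

lemma onorm_tri_interp:
  assumes "even a" "a > 0" "odd b"
  shows "onorm (tri_interp a b) = 1"
proof (rule antisym)
  show "onorm (tri_interp a b) \<le> 1"
    using norm_tri_interp_le[OF assms(1)] by (intro onorm_bound) auto
  show "1 \<le> onorm (tri_interp a b)"
    by (rule onorm_projection_onto_monomials_ge_1[OF projection_onto_tri_interp[OF assms]])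
qed

theorem mainTheorem3:
  shows "(\<forall>a b :: nat. even a \<and> a > 0 \<and> odd b \<and> b > 0 \<longrightarrow>
            (\<exists>P :: C \<Rightarrow> C.
               projection_onto P (span {monomial 0, monomial a, monomial (a + b)}) \<and> onorm P = 1))
         \<and> projection_constant (span {monomial 0, monomial 2, monomial 3}) = 1"
proof (intro conjI allI impI)
  fix a b :: nat
  assume "even a \<and> a > 0 \<and> odd b \<and> b > 0"
  then show "\<exists>P :: C \<Rightarrow> C.
      projection_onto P (span {monomial 0, monomial a, monomial (a + b)}) \<and> onorm P = 1"
    using projection_onto_tri_interp onorm_tri_interp by blast
next
  have "projection_onto (tri_interp 2 1) (span {monomial 0, monomial 2, monomial 3})"
    using projection_onto_tri_interp[of 2 1] by simp
  moreover have "onorm (tri_interp 2 1) = 1"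
    by (rule onorm_tri_interp) simp_all
  ultimately show "projection_constant (span {monomial 0, monomial 2, monomial 3}) = 1"
    unfolding projection_constant_def
    \<comment> \<open>The value 1 is attained by \<open>tri_interp 2 1\<close> and bounds all
      competitors from below, so the minimum exists and equals 1.\<close>
    by (intro Least_equality) (auto intro: onorm_projection_onto_monomials_ge_1)
qed

end
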